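(* Let $J$ be a $\times d$-invariant set satisfying (i) $d$ is prime and (ii) $0,d-1\in E$ and $E$ contains no two integers differing by $1$. Let $\delta$ be the Hausdorff dimension of $J$ and $\mu=\mathcal{H}^\delta|_J/\mathcal{H}^\delta(J)$. Then for $\mu$-almost every $x\in J$ and every constant $K>0$, the set of $y\in J_x$ that are badly intrinsically approximable (relative to $J_x$) with respect to the constant function $\psi(q)=K$ has Hausdorff dimension $\delta$.
   Context: Fix an integer $d\ge2$ and $E\subseteq\{0,\dots,d-1\}$ with $1<\#E<d$. The $\times d$-invariant set is $J=\{x\in[0,1]: x=\sum_{i\ge1}a_id^{-i}\text{ with all }a_i\in E\}$. For $x\in\mathbb{R}$, $J_x=\{t-x:t\in J\}$. For $S\subseteq\mathbb{R}$, $\psi:\mathbb{N}\to(0,\infty)$: $y\in S$ is intrinsically approximable w.r.t. $\psi$ if there are infinitely many $p/q\in\mathbb{Q}\cap S$ (lowest terms) with $|y-p/q|\le\psi(q)/q$; $y$ is badly intrinsically approximable w.r.t. $\psi$ if for some $\varepsilon>0$ it is not intrinsically approximable w.r.t. $\varepsilon\psi$. *)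

theory Defs
  imports "HOL-Analysis.Analysis"
begin

text \<open>s-dimensional contribution of a covering set: diam(C)^s, with diam(empty)^s = 0
  and diam(C)^0 = 1 for nonempty C (standard convention).\<close>
definition hd_term :: "real \<Rightarrow> real set \<Rightarrow> ennreal" where
  "hd_term s C = (if C = {} then 0 else if s = 0 then 1 else ennreal (diameter C powr s))"

definition hausdorff_pre :: "real \<Rightarrow> real \<Rightarrow> real set \<Rightarrow> ennreal" where
  "hausdorff_pre s eps A =
     (INF C \<in> {C :: nat \<Rightarrow> real set. A \<subseteq> (\<Union>i. C i) \<and>
                 (\<forall>i. bounded (C i) \<and> diameter (C i) \<le> eps)}.
        (\<Sum>i. hd_term s (C i)))"

definition hausdorff_measure :: "real \<Rightarrow> real set \<Rightarrow> ennreal" where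
  "hausdorff_measure s A = (SUP eps \<in> {0<..}. hausdorff_pre s eps A)"

definition hausdorff_dim :: "real set \<Rightarrow> real" where
  "hausdorff_dim A = Inf {s. 0 \<le> s \<and> hausdorff_measure s A = 0}"

definition digit_set :: "nat \<Rightarrow> nat set \<Rightarrow> real set" where
  "digit_set d E = {x. \<exists>a :: nat \<Rightarrow> nat. (\<forall>i. a i \<in> E) \<and>
                         (\<lambda>i. real (a i) / real d ^ Suc i) sums x}"

definition translate :: "real set \<Rightarrow> real \<Rightarrow> real set" where
  "translate J x = (\<lambda>t. t - x) ` J"

definition intr_approx :: "real set \<Rightarrow> (nat \<Rightarrow> real) \<Rightarrow> real \<Rightarrow> bool" where
  "intr_approx S psi y \<longleftrightarrow>
     infinite {(p :: int, q :: nat). 0 < q \<and> coprime p (int q) \<and>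
                 real_of_int p / real q \<in> S \<and>
                 \<bar>y - real_of_int p / real q\<bar> \<le> psi q / real q}"

definition badly_intr_approx :: "real set \<Rightarrow> (nat \<Rightarrow> real) \<Rightarrow> real \<Rightarrow> bool" where
  "badly_intr_approx S psi y \<longleftrightarrow>
     y \<in> S \<and> (\<exists>eps > 0. \<not> intr_approx S (\<lambda>q. eps * psi q) y)"

end

theory Submission
  imports Defs
begin

text \<open>Since \<open>E\<close> has no two adjacent digits, two integers whose base-\<open>d\<close> digits lie in \<open>E\<close> never differ
  by 1, so distinct cylinders of level \<open>n\<close> of the digit set \<open>J\<close> are at distance at least \<open>d ^ (-n)\<close>.

  Let \<open>r\<close> be a rational whose denominator is not a divisor of a power of \<open>d\<close>. For \<open>x\<close> with \<open>x\<close> and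
  \<open>x + r\<close> in \<open>J\<close>, every prefix of \<open>x\<close> determines the corresponding prefix of \<open>x + r\<close>, and forbids
  one of the blocks \<open>0...0\<close> and \<open>(d-1)...(d-1)\<close> of a fixed length \<open>m\<close> to come next. Hence \<open>J \<inter> (J - r)\<close>
  is a null set. So for almost every \<open>x\<close> every rational in \<open>J - x\<close> has, \<open>d\<close> being prime, a
  denominator \<open>d ^ n\<close>, and is \<open>t - x\<close> where \<open>t\<close> and \<open>x\<close> have the same digits after position \<open>n\<close>.
  If \<open>s\<close> in \<open>J\<close> differs from \<open>x\<close> at all positions divisible by \<open>k\<close>, then \<open>s - t\<close> is at least
  \<open>d ^ (-n-k)\<close> in absolute value, so \<open>s - x\<close> is badly approximable. These \<open>s\<close> form a set of dimension
  at least \<open>(1 - 1/k)\<close> times that of \<open>J\<close>, because \<open>[0,1)\<close> can be encoded in the free digits by a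
  map whose inverse is Hoelder continuous with this exponent.\<close>

section \<open>Hausdorff measure\<close>

lemma hausdorff_measure_eq_0_iff:
  "hausdorff_measure s A = 0 \<longleftrightarrow> (\<forall>\<epsilon>>0. hausdorff_pre s \<epsilon> A = 0)"
  using SUP_bot_conv(1)[of "\<lambda>\<epsilon>. hausdorff_pre s \<epsilon> A" "{0<..}"]
  unfolding hausdorff_measure_def bot_ennreal by (simp only: Ball_def greaterThan_iff)

lemma hausdorff_pre_eq_0_iff:
  "hausdorff_pre s \<epsilon> A = 0 \<longleftrightarrow>
    (\<forall>\<eta>>0. \<exists>C :: nat \<Rightarrow> real set. A \<subseteq> (\<Union>i. C i) \<and>
       (\<forall>i. bounded (C i) \<and> diameter (C i) \<le> \<epsilon>) \<and> (\<Sum>i. hd_term s (C i)) < ennreal \<eta>)"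
    (is "?L \<longleftrightarrow> ?R")
proof
  assume ?L
  show ?R
  proof (intro allI impI)
    fix \<eta> :: real assume "\<eta> > 0"
    with \<open>?L\<close> have "hausdorff_pre s \<epsilon> A < ennreal \<eta>" by simp
    then show "\<exists>C :: nat \<Rightarrow> real set. A \<subseteq> (\<Union>i. C i) \<and>
       (\<forall>i. bounded (C i) \<and> diameter (C i) \<le> \<epsilon>) \<and> (\<Sum>i. hd_term s (C i)) < ennreal \<eta>"
      unfolding hausdorff_pre_def INF_less_iff by blast
  qed
next
  assume ?R
  have "hausdorff_pre s \<epsilon> A \<le> 0 + ennreal \<eta>" if "\<eta> > 0" for \<eta>
  proof -
    from \<open>?R\<close> that obtain C :: "nat \<Rightarrow> real set" where "A \<subseteq> (\<Union>i. C i)"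
       "\<forall>i. bounded (C i) \<and> diameter (C i) \<le> \<epsilon>" and lt: "(\<Sum>i. hd_term s (C i)) < ennreal \<eta>"
      by blast
    then have "hausdorff_pre s \<epsilon> A \<le> (\<Sum>i. hd_term s (C i))"
      unfolding hausdorff_pre_def by (intro INF_lower) auto
    with lt show ?thesis by auto
  qed
  then have "hausdorff_pre s \<epsilon> A \<le> 0" by (rule ennreal_le_epsilon)
  then show ?L by simp
qed

lemma hausdorff_measure_0_subset:
  assumes "hausdorff_measure s B = 0" "A \<subseteq> B"
  shows "hausdorff_measure s A = 0"
proof -
  have "hausdorff_pre s \<epsilon> A \<le> hausdorff_pre s \<epsilon> B" for \<epsilon>
    unfolding hausdorff_pre_def by (rule INF_superset_mono) (use assms(2) in auto)
  with assms(1) show ?thesis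
    unfolding hausdorff_measure_eq_0_iff by (metis le_zero_eq)
qed

lemma hausdorff_measure_0_UN_nat:
  fixes A :: "nat \<Rightarrow> real set"
  assumes "\<And>n. hausdorff_measure s (A n) = 0"
  shows "hausdorff_measure s (\<Union>n. A n) = 0"
  unfolding hausdorff_measure_eq_0_iff hausdorff_pre_eq_0_iff
proof (intro allI impI)
  fix \<epsilon> \<eta> :: real assume pos: "\<epsilon> > 0" "\<eta> > 0"
  \<comment> \<open>The budgets sum to \<open>\<eta> / 2\<close> rather than \<open>\<eta>\<close>,
    because passing to the sum of the series only preserves a weak inequality.\<close>
  have "\<exists>C :: nat \<Rightarrow> real set. A n \<subseteq> (\<Union>i. C i) \<and>
       (\<forall>i. bounded (C i) \<and> diameter (C i) \<le> \<epsilon>) \<and>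
       (\<Sum>i. hd_term s (C i)) < ennreal (\<eta> / 2 * (1/2) ^ Suc n)" for n
    using assms[of n] pos unfolding hausdorff_measure_eq_0_iff hausdorff_pre_eq_0_iff by simp
  then obtain C :: "nat \<Rightarrow> nat \<Rightarrow> real set" where C: "\<And>n. A n \<subseteq> (\<Union>i. C n i)"
       "\<And>n i. bounded (C n i)" "\<And>n i. diameter (C n i) \<le> \<epsilon>"
       "\<And>n. (\<Sum>i. hd_term s (C n i)) < ennreal (\<eta> / 2 * (1/2) ^ Suc n)"
    by metis
  define D where "D = (\<lambda>m. case prod_decode m of (n, i) \<Rightarrow> C n i)"
  have "(\<Union>n. A n) \<subseteq> (\<Union>m. D m)"
  proof
    fix x assume "x \<in> (\<Union>n. A n)"
    then obtain n i where "x \<in> C n i" using C(1) by blast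
    then have "x \<in> D (prod_encode (n, i))" by (simp add: D_def)
    then show "x \<in> (\<Union>m. D m)" by blast
  qed
  moreover have "bounded (D m) \<and> diameter (D m) \<le> \<epsilon>" for m
    using C(2,3) by (simp add: D_def split: prod.split)
  moreover have "(\<Sum>m. hd_term s (D m)) < ennreal \<eta>"
  proof -
    have "(\<Sum>m. hd_term s (D m)) = (\<Sum>n. \<Sum>i. hd_term s (C n i))"
    proof -
      have "(\<Sum>m. hd_term s (D m)) = (\<Sum>m. (\<lambda>(n, i). hd_term s (C n i)) (prod_decode m))"
        by (simp add: D_def prod.case_distrib)
      also have "\<dots> = (\<Sum>n. \<Sum>i. hd_term s (C n i))"
        by (intro suminf_ennreal_2dimen) auto
      finally show ?thesis .
    qed
    also have "\<dots> \<le> (\<Sum>n. ennreal (\<eta> / 2 * (1/2) ^ Suc n))"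
      using C(4) by (intro suminf_le) (auto intro: less_imp_le)
    also have "\<dots> = ennreal (\<eta> / 2 * 1)"
    proof (rule suminf_ennreal_eq)
      show "(\<lambda>n. \<eta> / 2 * (1/2) ^ Suc n) sums (\<eta> / 2 * 1)"
        by (intro sums_mult power_half_series)
    qed (use pos in auto)
    also have "\<dots> < ennreal \<eta>" using pos by (intro ennreal_lessI) auto
    finally show ?thesis .
  qed
  ultimately show "\<exists>C :: nat \<Rightarrow> real set. (\<Union>n. A n) \<subseteq> (\<Union>i. C i) \<and>
       (\<forall>i. bounded (C i) \<and> diameter (C i) \<le> \<epsilon>) \<and> (\<Sum>i. hd_term s (C i)) < ennreal \<eta>"
    by blast
qed

lemma hausdorff_measure_0_empty: "hausdorff_measure s {} = 0"
  unfolding hausdorff_measure_eq_0_iff hausdorff_pre_eq_0_iff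
proof (intro allI impI)
  fix \<epsilon> \<eta> :: real assume "\<epsilon> > 0" "\<eta> > 0"
  then show "\<exists>C :: nat \<Rightarrow> real set. {} \<subseteq> (\<Union>i. C i) \<and>
       (\<forall>i. bounded (C i) \<and> diameter (C i) \<le> \<epsilon>) \<and> (\<Sum>i. hd_term s (C i)) < ennreal \<eta>"
    by (intro exI[of _ "\<lambda>_. {}"]) (auto simp: hd_term_def)
qed

lemma hausdorff_measure_0_UN:
  assumes "countable I" "\<And>i. i \<in> I \<Longrightarrow> hausdorff_measure s (A i) = 0"
  shows "hausdorff_measure s (\<Union>i\<in>I. A i) = 0"
proof (cases "I = {}")
  case True
  then show ?thesis by (simp add: hausdorff_measure_0_empty)
next
  case False
  have "(\<Union>i\<in>I. A i) = (\<Union>n. A (from_nat_into I n))"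
    using False assms(1) by (metis image_image range_from_nat_into)
  then show ?thesis
    using assms(2) from_nat_into[OF False] by (simp add: hausdorff_measure_0_UN_nat)
qed

lemma hausdorff_measure_0_Un:
  assumes "hausdorff_measure s A = 0" "hausdorff_measure s B = 0"
  shows "hausdorff_measure s (A \<union> B) = 0"
  using hausdorff_measure_0_UN[of "{True, False}" s "\<lambda>b. if b then A else B"] assms
  by (simp add: Un_commute)

text \<open>A single \<open>\<epsilon>\<close> controls both the mesh and the total contribution, so
  finite covers by sets of one common size suffice. The case \<open>\<rho> = 0\<close> is allowed,
  which handles single points.\<close>

lemma hausdorff_measure_0_finite_covers:
  fixes A :: "real set"
  assumes "s > 0"
    and cov: "\<And>\<epsilon>. \<epsilon> > 0 \<Longrightarrow> \<exists>(I :: nat set) C \<rho>. finite I \<and> A \<subseteq> (\<Union>i\<in>I. C i) \<and> 0 \<le> \<rho> \<and> \<rho> \<le> \<epsilon> \<and>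
      (\<forall>i\<in>I. bounded (C i) \<and> diameter (C i) \<le> \<rho>) \<and> real (card I) * \<rho> powr s < \<epsilon>"
  shows "hausdorff_measure s A = 0"
  unfolding hausdorff_measure_eq_0_iff hausdorff_pre_eq_0_iff
proof (intro allI impI)
  fix \<epsilon> \<eta> :: real assume pos: "\<epsilon> > 0" "\<eta> > 0"
  then have "min \<epsilon> \<eta> > 0" by simp
  from cov[OF this] obtain I :: "nat set" and C \<rho> where C: "finite I" "A \<subseteq> (\<Union>i\<in>I. C i)"
    "0 \<le> \<rho>" "\<rho> \<le> min \<epsilon> \<eta>" "\<forall>i\<in>I. bounded (C i) \<and> diameter (C i) \<le> \<rho>"
    "real (card I) * \<rho> powr s < min \<epsilon> \<eta>"
    by blast
  \<comment> \<open>Padding with empty sets is free, since \<open>hd_term s {} = 0\<close>.\<close>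
  define D where "D i = (if i \<in> I then C i else {})" for i
  have "(\<Sum>i. hd_term s (D i)) = (\<Sum>i\<in>I. hd_term s (D i))"
    by (intro suminf_finite) (use C(1) in \<open>auto simp: D_def hd_term_def\<close>)
  also have "\<dots> \<le> (\<Sum>i\<in>I. ennreal (\<rho> powr s))"
  proof (intro sum_mono)
    fix i assume "i \<in> I"
    then show "hd_term s (D i) \<le> ennreal (\<rho> powr s)"
      using C(5) \<open>s > 0\<close> by (auto simp: D_def hd_term_def intro!: ennreal_leI powr_mono2 diameter_ge_0)
  qed
  also have "\<dots> = ennreal (real (card I) * \<rho> powr s)"
    by (simp add: ennreal_mult ennreal_of_nat_eq_real_of_nat)
  also have "\<dots> < ennreal \<eta>"
    using C(6) pos by (intro ennreal_lessI) auto
  finally show "\<exists>C :: nat \<Rightarrow> real set. A \<subseteq> (\<Union>i. C i) \<and>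
       (\<forall>i. bounded (C i) \<and> diameter (C i) \<le> \<epsilon>) \<and> (\<Sum>i. hd_term s (C i)) < ennreal \<eta>"
    using C pos by (intro exI[of _ D]) (fastforce simp: D_def)
qed

lemma hausdorff_measure_0_countable:
  assumes "s > 0" "countable A"
  shows "hausdorff_measure s A = 0"
proof -
  have "hausdorff_measure s {x} = 0" for x
  proof (rule hausdorff_measure_0_finite_covers[OF assms(1)])
    fix \<epsilon> :: real assume "\<epsilon> > 0"
    then show "\<exists>(I :: nat set) C \<rho>. finite I \<and> {x} \<subseteq> (\<Union>i\<in>I. C i) \<and> 0 \<le> \<rho> \<and> \<rho> \<le> \<epsilon> \<and>
      (\<forall>i\<in>I. bounded (C i) \<and> diameter (C i) \<le> \<rho>) \<and> real (card I) * \<rho> powr s < \<epsilon>"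
      by (intro exI[of _ "{0}"] exI[of _ "\<lambda>_. {x}"] exI[of _ 0]) auto
  qed
  then have "hausdorff_measure s (\<Union>x\<in>A. {x}) = 0"
    using assms(2) by (intro hausdorff_measure_0_UN) auto
  then show ?thesis by simp
qed

text \<open>A cover of \<open>A\<close> pulls back along \<open>h\<close> to a cover of the unit
  interval. Each pulled back set has length at most a constant times
  \<open>diameter (C i) powr \<alpha>\<close>, so the contributions of the cover cannot sum to less
  than \<open>1 / (2 * L)\<close>. Enclosing the preimages in intervals avoids any question of their
  measurability.\<close>

lemma hausdorff_measure_pos_of_expanding:
  fixes h :: "real \<Rightarrow> real"
  assumes h: "\<And>z. z \<in> {0..<1} \<Longrightarrow> h z \<in> A"
    and ex: "\<And>z z'. z \<in> {0..<1} \<Longrightarrow> z' \<in> {0..<1} \<Longrightarrow> \<bar>z - z'\<bar> \<le> L * \<bar>h z - h z'\<bar> powr \<alpha>"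
    and "0 \<le> s" "s \<le> \<alpha>" "0 < \<alpha>" "0 < L"
  shows "hausdorff_measure s A \<noteq> 0"
proof
  assume "hausdorff_measure s A = 0"
  then have "hausdorff_pre s 1 A = 0" by (simp add: hausdorff_measure_eq_0_iff)
  moreover have "1 / (2 * L) > 0" using \<open>0 < L\<close> by simp
  ultimately have "\<exists>C :: nat \<Rightarrow> real set. A \<subseteq> (\<Union>i. C i) \<and>
       (\<forall>i. bounded (C i) \<and> diameter (C i) \<le> 1) \<and> (\<Sum>i. hd_term s (C i)) < ennreal (1 / (2 * L))"
    unfolding hausdorff_pre_eq_0_iff by (elim allE impE) assumption+
  then obtain C :: "nat \<Rightarrow> real set" where C: "A \<subseteq> (\<Union>i. C i)"
       "\<And>i. bounded (C i)" "\<And>i. diameter (C i) \<le> 1"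
       and lt: "(\<Sum>i. hd_term s (C i)) < ennreal (1 / (2 * L))"
    by metis
  have "\<exists>a b. {z \<in> {0..<1}. h z \<in> C i} \<subseteq> {a..b} \<and>
      emeasure lborel {a..b} \<le> ennreal (2 * L) * hd_term s (C i)" for i
  proof (cases "{z \<in> {0..<1}. h z \<in> C i} = {}")
    case True
    then show ?thesis by (intro exI[of _ 1] exI[of _ 0]) auto
  next
    case False
    then obtain z where z: "z \<in> {0..<1}" "h z \<in> C i" by blast
    define l where "l = L * diameter (C i) powr \<alpha>"
    have l0: "l \<ge> 0" using \<open>0 < L\<close> by (simp add: l_def)
    have "\<bar>z - z'\<bar> \<le> l" if "z' \<in> {0..<1}" "h z' \<in> C i" for z'
    proof -
      have "\<bar>h z - h z'\<bar> \<le> diameter (C i)"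
        using diameter_bounded_bound[OF C(2) z(2) that(2)] by (simp add: dist_real_def)
      then have "\<bar>h z - h z'\<bar> powr \<alpha> \<le> diameter (C i) powr \<alpha>"
        using \<open>0 < \<alpha>\<close> by (intro powr_mono2) auto
      then show ?thesis
        using ex[OF z(1) that(1)] \<open>0 < L\<close> unfolding l_def
        by (meson mult_left_mono less_imp_le order_trans)
    qed
    then have "{z \<in> {0..<1}. h z \<in> C i} \<subseteq> {z - l..z + l}" by (force simp: abs_le_iff)
    moreover have "emeasure lborel {z - l..z + l} \<le> ennreal (2 * L) * hd_term s (C i)"
    proof -
      \<comment> \<open>Diameters are at most 1, so lowering the exponent from
        \<open>\<alpha>\<close> to \<open>s\<close> increases the power. The exponent 0 is separate
        because \<open>hd_term\<close> then assigns 1 even to a set of diameter 0.\<close>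
      have "ennreal (diameter (C i) powr \<alpha>) \<le> hd_term s (C i)"
      proof (cases "s = 0")
        case True
        have "diameter (C i) powr \<alpha> \<le> 1"
          using C(2,3) \<open>0 < \<alpha>\<close> powr_mono2[of \<alpha> "diameter (C i)" 1]
          by (simp add: diameter_ge_0)
        then show ?thesis using True z by (auto simp: hd_term_def)
      next
        case False
        have "diameter (C i) powr \<alpha> \<le> diameter (C i) powr s"
          using C(2,3) \<open>s \<le> \<alpha>\<close> by (intro powr_mono') (auto simp: diameter_ge_0)
        then show ?thesis using False z by (auto simp: hd_term_def intro: ennreal_leI)
      qed
      then have "ennreal (2 * L) * ennreal (diameter (C i) powr \<alpha>) \<le> ennreal (2 * L) * hd_term s (C i)"
        by (intro mult_left_mono) auto
      moreover have "emeasure lborel {z - l..z + l} = ennreal (2 * L) * ennreal (diameter (C i) powr \<alpha>)"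
        using l0 \<open>0 < L\<close> by (simp add: l_def flip: ennreal_mult)
      ultimately show ?thesis by simp
    qed
    ultimately show ?thesis by blast
  qed
  then obtain a b where ab: "\<And>i. {z \<in> {0..<1}. h z \<in> C i} \<subseteq> {a i..b i}"
      "\<And>i. emeasure lborel {a i..b i} \<le> ennreal (2 * L) * hd_term s (C i)"
    by metis
  have "(1::ennreal) = emeasure lborel {0..<1::real}" by simp
  also have "\<dots> \<le> emeasure lborel (\<Union>i. {a i..b i})"
  proof (rule emeasure_mono)
    show "{0..<1} \<subseteq> (\<Union>i. {a i..b i})"
    proof
      fix z :: real assume z: "z \<in> {0..<1}"
      then obtain i where "h z \<in> C i" using h C(1) by blast
      then show "z \<in> (\<Union>i. {a i..b i})" using ab(1)[of i] z by blast
    qed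
  qed auto
  also have "\<dots> \<le> (\<Sum>i. emeasure lborel {a i..b i})"
    by (intro emeasure_subadditive_countably) auto
  also have "\<dots> \<le> (\<Sum>i. ennreal (2 * L) * hd_term s (C i))"
    by (intro suminf_le ab) auto
  also have "\<dots> = ennreal (2 * L) * (\<Sum>i. hd_term s (C i))" by simp
  also have "\<dots> < ennreal (2 * L) * ennreal (1 / (2 * L))"
    using lt \<open>0 < L\<close> by (intro ennreal_mult_strict_left_mono) auto
  also have "\<dots> = 1" using \<open>0 < L\<close> by (simp flip: ennreal_mult)
  finally show False by simp
qed

lemma hausdorff_dim_eqI:
  assumes "\<delta> \<ge> 0"
    and "\<And>s. s > \<delta> \<Longrightarrow> hausdorff_measure s A = 0"
    and "\<And>s. 0 \<le> s \<Longrightarrow> s < \<delta> \<Longrightarrow> hausdorff_measure s A \<noteq> 0"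
  shows "hausdorff_dim A = \<delta>"
proof (rule antisym)
  have "bdd_below {s. 0 \<le> s \<and> hausdorff_measure s A = 0}"
    by (auto simp: bdd_below_def)
  then have "hausdorff_dim A \<le> s" if "s > \<delta>" for s
    using assms(1,2) that unfolding hausdorff_dim_def by (intro cInf_lower) auto
  then show "hausdorff_dim A \<le> \<delta>" by (rule dense_ge)
  have "\<delta> + 1 \<in> {s. 0 \<le> s \<and> hausdorff_measure s A = 0}" using assms(1,2) by simp
  then show "\<delta> \<le> hausdorff_dim A"
    unfolding hausdorff_dim_def using assms(3) by (intro cInf_greatest) (auto intro: leI)
qed

section \<open>Digit expansions\<close>

definition digit_val :: "nat \<Rightarrow> (nat \<Rightarrow> nat) \<Rightarrow> real" where
  "digit_val d a = (\<Sum>i. real (a i) / real d ^ Suc i)"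

text \<open>This is \<open>d ^ n\<close> times the partial sum of the first \<open>n\<close> terms
  of \<open>digit_val\<close>. Being an integer, it turns distances between cylinders into
  differences of integers.\<close>

primrec digit_prefix :: "nat \<Rightarrow> (nat \<Rightarrow> nat) \<Rightarrow> nat \<Rightarrow> nat" where
  "digit_prefix d a 0 = 0"
| "digit_prefix d a (Suc n) = d * digit_prefix d a n + a n"

lemma digit_prefix_add:
  "digit_prefix d a (n + m) = d ^ m * digit_prefix d a n + digit_prefix d (\<lambda>i. a (i + n)) m"
  by (induction m) (simp_all add: algebra_simps)

lemma digit_prefix_eq_imp:
  assumes "\<And>i. a i < d" "\<And>i. b i < d" "digit_prefix d a n = digit_prefix d b n" "i < n"
  shows "a i = b i"
  using assms(3,4)
proof (induction n)
  case (Suc n)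
  have "a n = (d * digit_prefix d a n + a n) mod d" "b n = (d * digit_prefix d b n + b n) mod d"
    using assms(1,2) by simp_all
  then have "a n = b n" using Suc.prems(1) by (metis digit_prefix.simps(2))
  moreover have "d > 0" using assms(1)[of 0] by simp
  ultimately have "digit_prefix d a n = digit_prefix d b n" using Suc.prems(1) by simp
  then show ?case using Suc \<open>a n = b n\<close> by (cases "i = n") auto
qed simp

context
  fixes d :: nat and a :: "nat \<Rightarrow> nat"
  assumes d2: "d \<ge> 2" and a: "\<And>i. a i < d"
begin

lemma sums_max_digits: "(\<lambda>i. (real d - 1) / real d ^ Suc i) sums 1"
proof -
  have "(\<lambda>i. (real d - 1) / real d * (1 / real d) ^ i) sums
      ((real d - 1) / real d * (1 / (1 - 1 / real d)))"
    using d2 by (intro sums_mult geometric_sums) auto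
  moreover have "(real d - 1) / real d * (1 / (1 - 1 / real d)) = 1"
    using d2 by (simp add: field_simps)
  moreover have "(real d - 1) / real d * (1 / real d) ^ i = (real d - 1) / real d ^ Suc i" for i
    by (simp add: power_divide)
  ultimately show ?thesis by (simp only:)
qed

lemma digit_term_le: "real (a i) / real d ^ Suc i \<le> (real d - 1) / real d ^ Suc i"
  using a[of i] d2 by (intro divide_right_mono) auto

lemma summable_digits: "summable (\<lambda>i. real (a i) / real d ^ Suc i)"
  by (rule summable_comparison_test'[OF sums_summable[OF sums_max_digits], of 0])
    (use digit_term_le in simp)

lemma digit_val_nonneg: "0 \<le> digit_val d a"
  unfolding digit_val_def by (intro suminf_nonneg summable_digits) auto

lemma digit_val_le_1: "digit_val d a \<le> 1"
proof -
  have "digit_val d a \<le> (\<Sum>i. (real d - 1) / real d ^ Suc i)"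
    unfolding digit_val_def
    by (intro suminf_le summable_digits sums_summable[OF sums_max_digits] digit_term_le)
  also have "\<dots> = 1" using sums_max_digits by (rule sums_unique[symmetric])
  finally show ?thesis .
qed

text \<open>Multiplication by \<open>d ^ n\<close> acts on expansions as the shift by
  \<open>n\<close>, up to an integer. The tail ranges over the closed interval from 0 to 1, so the
  prefix need not be the floor of the left side.\<close>

lemma digit_val_split:
  "real d ^ n * digit_val d a = real (digit_prefix d a n) + digit_val d (\<lambda>i. a (i + n))"
proof -
  have d0: "real d \<noteq> 0" using d2 by simp
  have pre: "real d ^ n * (\<Sum>i<n. real (a i) / real d ^ Suc i) = real (digit_prefix d a n)"
  proof (induction n)
    case (Suc n)
    have "real d ^ Suc n * (\<Sum>i<Suc n. real (a i) / real d ^ Suc i)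
        = real d * (real d ^ n * (\<Sum>i<n. real (a i) / real d ^ Suc i)) + real (a n)"
      using d0 by (simp add: distrib_left)
    then show ?case by (simp only: Suc.IH) simp
  qed simp
  have "real d ^ n * (\<Sum>i. real (a (i + n)) / real d ^ Suc (i + n))
      = (\<Sum>i. real d ^ n * (real (a (i + n)) / real d ^ Suc (i + n)))"
    using summable_ignore_initial_segment[OF summable_digits, of n] by (rule suminf_mult[symmetric])
  also have "\<dots> = (\<Sum>i. real (a (i + n)) / real d ^ Suc i)"
    using d0 by (simp add: power_add)
  finally have tail: "real d ^ n * (\<Sum>i. real (a (i + n)) / real d ^ Suc (i + n))
      = digit_val d (\<lambda>i. a (i + n))"
    unfolding digit_val_def .
  have "digit_val d a = (\<Sum>i. real (a (i + n)) / real d ^ Suc (i + n))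
      + (\<Sum>i<n. real (a i) / real d ^ Suc i)"
    unfolding digit_val_def by (rule suminf_split_initial_segment[OF summable_digits])
  then show ?thesis by (simp only: distrib_left tail pre add.commute)
qed

end

section \<open>Integers with digits in a given set\<close>

primrec digit_words :: "nat \<Rightarrow> nat set \<Rightarrow> nat \<Rightarrow> nat set" where
  "digit_words d E 0 = {0}"
| "digit_words d E (Suc n) = (\<lambda>(w, e). d * w + e) ` (digit_words d E n \<times> E)"

lemma digit_prefix_in_words:
  "(\<And>i. a i \<in> E) \<Longrightarrow> digit_prefix d a n \<in> digit_words d E n"
  by (induction n) auto

lemma finite_digit_words: "finite E \<Longrightarrow> finite (digit_words d E n)"
  by (induction n) auto

lemma card_digit_words_le:
  assumes "finite E"
  shows "card (digit_words d E n) \<le> card E ^ n"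
proof (induction n)
  case (Suc n)
  have "card (digit_words d E (Suc n)) \<le> card (digit_words d E n \<times> E)"
    unfolding digit_words.simps by (intro card_image_le) (simp add: assms finite_digit_words)
  also have "\<dots> \<le> card E ^ Suc n" using Suc by (simp add: card_cartesian_product)
  finally show ?case .
qed simp

lemma zero_in_digit_words: "0 \<in> E \<Longrightarrow> 0 \<in> digit_words d E n"
proof (induction n)
  case (Suc n)
  then have "(\<lambda>(w, e). d * w + e) (0, 0) \<in> digit_words d E (Suc n)"
    unfolding digit_words.simps by (intro imageI) simp
  then show ?case by simp
qed simp

lemma max_in_digit_words:
  assumes "d > 0" "d - 1 \<in> E"
  shows "d ^ n - 1 \<in> digit_words d E n"
proof (induction n)
  case (Suc n)
  have "d ^ n > 0" using assms(1) by simp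
  then have "d * (d ^ n - 1) + (d - 1) = d ^ Suc n - 1"
    using assms(1) by (simp add: algebra_simps)
  moreover have "(\<lambda>(w, e). d * w + e) (d ^ n - 1, d - 1) \<in> digit_words d E (Suc n)"
    unfolding digit_words.simps using Suc assms(2) by (intro imageI) simp
  ultimately show ?case by simp
qed simp

text \<open>The digits determine the integer part of \<open>N ^ m * z\<close> recursively, starting
  from the integer part 0 of a number in [0,1).\<close>

lemma nary_digits_eq_imp_close:
  fixes z z' :: real and N :: nat
  assumes "N > 0" "z \<in> {0..<1}" "z' \<in> {0..<1}"
    and eq: "\<And>i. i < m \<Longrightarrow> \<lfloor>real N ^ Suc i * z\<rfloor> mod int N = \<lfloor>real N ^ Suc i * z'\<rfloor> mod int N"
  shows "\<bar>z - z'\<bar> \<le> 1 / real N ^ m"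
proof -
  have "\<lfloor>real N ^ m * z\<rfloor> = \<lfloor>real N ^ m * z'\<rfloor>"
    using eq
  proof (induction m)
    case 0
    have "\<lfloor>z\<rfloor> = 0" "\<lfloor>z'\<rfloor> = 0" using assms(2,3) by (auto simp: floor_eq_iff)
    then show ?case by simp
  next
    case (Suc m)
    have div: "\<lfloor>real N ^ Suc m * u\<rfloor> div int N = \<lfloor>real N ^ m * u\<rfloor>" for u
      using floor_divide_real_eq_div[of "int N" "real N ^ Suc m * u"] assms(1) by simp
    have "\<lfloor>real N ^ Suc m * u\<rfloor> = int N * \<lfloor>real N ^ m * u\<rfloor> + \<lfloor>real N ^ Suc m * u\<rfloor> mod int N" for u
      unfolding div[symmetric] by simp
    moreover have "\<lfloor>real N ^ m * z\<rfloor> = \<lfloor>real N ^ m * z'\<rfloor>" using Suc by simp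
    ultimately show ?case using Suc.prems[of m] by (metis lessI)
  qed
  then have "\<bar>real N ^ m * z - real N ^ m * z'\<bar> \<le> 1" by linarith
  then have "real N ^ m * \<bar>z - z'\<bar> \<le> 1" by (simp add: abs_mult flip: right_diff_distrib)
  then show ?thesis using assms(1) by (simp add: le_divide_eq mult.commute)
qed

section \<open>Digit sets without adjacent digits\<close>

text \<open>Only the conditions on the digits are collected here; primality of \<open>d\<close> is
  assumed separately where denominators are treated.\<close>

locale sparse_digits =
  fixes d :: nat and E :: "nat set"
  assumes d2: "d \<ge> 2" and E_less: "\<And>e. e \<in> E \<Longrightarrow> e < d"
    and zero_in_E: "0 \<in> E" and max_in_E: "d - 1 \<in> E"
    and sparse: "\<And>e. e \<in> E \<Longrightarrow> e + 1 \<notin> E"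
begin

lemma finite_E: "finite E"
  by (rule finite_subset[of E "{..<d}"]) (auto dest: E_less)

text \<open>Adding 1 either raises the last digit by 1, which \<open>sparse\<close> forbids, or
  carries past a last digit \<open>d - 1\<close>. In the second case the words without their last
  digits are adjacent, and induction applies.\<close>

lemma words_not_adjacent:
  "w \<in> digit_words d E n \<Longrightarrow> w + 1 \<notin> digit_words d E n"
proof (induction n arbitrary: w)
  case (Suc n)
  show ?case
  proof
    assume "w + 1 \<in> digit_words d E (Suc n)"
    then obtain v' e' where v': "w + 1 = d * v' + e'" "v' \<in> digit_words d E n" "e' \<in> E" by auto
    from Suc.prems obtain v e where v: "w = d * v + e" "v \<in> digit_words d E n" "e \<in> E" by auto
    have eq: "d * v + (e + 1) = d * v' + e'" using v(1) v'(1) by simp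
    have lt: "e' < d" "e < d" using E_less v(3) v'(3) by auto
    show False
    proof (cases "e + 1 < d")
      case True
      have "(d * v + (e + 1)) mod d = e + 1" "(d * v' + e') mod d = e'" using True lt by simp_all
      then have "e' = e + 1" using eq by metis
      then show False using sparse v v' by simp
    next
      case False
      then have "e + 1 = d" using lt by simp
      then have *: "d * (v + 1) + 0 = d * v' + e'" using eq by simp
      have "(d * (v + 1) + 0) div d = v + 1" "(d * v' + e') div d = v'" using lt d2 by simp_all
      then have "v' = v + 1" using * by metis
      then show False using Suc.IH[OF v(2)] v'(2) by simp
    qed
  qed
qed simp

lemma word_diff_ge_2:
  assumes "v \<in> digit_words d E n" "w \<in> digit_words d E n" "v \<noteq> w"
  shows "\<bar>real v - real w\<bar> \<ge> 2"
proof -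
  have "v \<noteq> w + 1" "w \<noteq> v + 1" using words_not_adjacent assms by metis+
  then have "v \<ge> w + 2 \<or> w \<ge> v + 2" using assms(3) by linarith
  then show ?thesis by linarith
qed

lemma digit_val_shift_bounds:
  assumes "\<forall>i. a i \<in> E"
  shows "0 \<le> digit_val d (\<lambda>i. a (i + n))" "digit_val d (\<lambda>i. a (i + n)) \<le> 1"
  using assms by (auto intro!: digit_val_nonneg[OF d2] digit_val_le_1[OF d2] E_less)

lemma digit_val_split_E:
  assumes "\<forall>i. a i \<in> E"
  shows "real d ^ n * digit_val d a = real (digit_prefix d a n) + digit_val d (\<lambda>i. a (i + n))"
  by (rule digit_val_split[OF d2]) (simp add: E_less assms)

text \<open>After scaling by \<open>d ^ n\<close> the prefixes differ by at least 2, while the tails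
  differ by at most 1.\<close>

lemma digit_val_separated:
  assumes a: "\<forall>i. a i \<in> E" and b: "\<forall>i. b i \<in> E" and "digit_prefix d a n \<noteq> digit_prefix d b n"
  shows "1 / real d ^ n \<le> \<bar>digit_val d a - digit_val d b\<bar>"
proof -
  have "2 \<le> \<bar>real (digit_prefix d a n) - real (digit_prefix d b n)\<bar>"
    using assms by (intro word_diff_ge_2[of _ n] digit_prefix_in_words) auto
  then have "1 \<le> \<bar>real d ^ n * digit_val d a - real d ^ n * digit_val d b\<bar>"
    using digit_val_split_E[OF a, where n = n] digit_val_split_E[OF b, where n = n]
      digit_val_shift_bounds[OF a, where n = n] digit_val_shift_bounds[OF b, where n = n] by linarith
  also have "\<dots> = real d ^ n * \<bar>digit_val d a - digit_val d b\<bar>"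
    by (simp add: abs_mult flip: right_diff_distrib)
  finally show ?thesis using d2 by (simp add: divide_le_eq mult.commute)
qed

lemma digit_set_eq: "digit_set d E = digit_val d ` {a. \<forall>i. a i \<in> E}"
proof -
  have "(\<lambda>i. real (a i) / real d ^ Suc i) sums x \<longleftrightarrow> x = digit_val d a" if "\<forall>i. a i \<in> E" for a x
  proof -
    have "a i < d" for i using that E_less by blast
    from summable_digits[OF d2 this] show ?thesis
      by (auto simp: digit_val_def sums_iff)
  qed
  then show ?thesis unfolding digit_set_def image_def by (intro Collect_cong) auto
qed

lemma digit_val_in_cylinder:
  assumes "\<forall>i. a i \<in> E"
  shows "digit_val d a \<in> {real (digit_prefix d a n) / real d ^ n..(real (digit_prefix d a n) + 1) / real d ^ n}"
proof -
  have "real d ^ n > 0" using d2 by simp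
  then show ?thesis
    using digit_val_split_E[OF assms, where n = n] digit_val_shift_bounds[OF assms, where n = n]
    by (simp add: divide_le_eq le_divide_eq mult.commute)
qed

section \<open>Similarity dimension and covers by cylinders\<close>

text \<open>The similarity dimension, characterised by \<open>powr_dim\<close>. Its agreement with
  the Hausdorff dimension is \<open>hausdorff_dim_digit_set\<close>.\<close>

definition dim :: real where "dim = log (real d) (real (card E))"

lemma card_E_ge_2: "card E \<ge> 2"
proof -
  have "card {0, d - 1} \<le> card E"
    using zero_in_E max_in_E finite_E by (intro card_mono) auto
  then show ?thesis using d2 by simp
qed

lemma dim_pos: "dim > 0"
  using card_E_ge_2 d2 by (simp add: dim_def zero_less_log_cancel_iff)

lemma powr_dim: "real d powr dim = real (card E)"
  using card_E_ge_2 d2 by (simp add: dim_def)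

lemma inverse_power_powr: "(1 / real d ^ n) powr s = (1 / real d powr s) ^ n"
proof -
  have "(1 / real d ^ n) powr s = (real d powr (- real n)) powr s"
    using d2 by (simp add: powr_minus powr_realpow divide_inverse)
  also have "\<dots> = (real d powr (- s)) powr real n"
    using d2 by (simp add: powr_powr mult.commute)
  also have "\<dots> = (1 / real d powr s) ^ n"
    using d2 by (simp add: powr_realpow powr_minus divide_inverse)
  finally show ?thesis .
qed

text \<open>Serves two purposes: with \<open>m = 1\<close> it gives the upper bound on the
  dimension, and with a longer block length it shows that intersections with rational translates are
  null. Both the cylinder length and the total contribution tend to 0 geometrically.\<close>

lemma hausdorff_measure_0_word_covers:
  assumes "s > 0" "0 \<le> \<theta>" "\<theta> < 1" "m > 0"
    and cov: "\<And>n. \<exists>I. finite I \<and>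
      A \<subseteq> (\<Union>w\<in>I. {real w / real d ^ (m * n) - x..(real w + 1) / real d ^ (m * n) - x}) \<and>
      real (card I) * (1 / real d ^ (m * n)) powr s \<le> \<theta> ^ n"
  shows "hausdorff_measure s A = 0"
proof (rule hausdorff_measure_0_finite_covers[OF \<open>s > 0\<close>])
  fix \<epsilon> :: real assume "\<epsilon> > 0"
  have "(\<lambda>n. \<theta> ^ n) \<longlonglongrightarrow> 0" using assms by (intro LIMSEQ_power_zero) auto
  moreover have "(\<lambda>n. (1 / real d) ^ n) \<longlonglongrightarrow> 0" using d2 by (intro LIMSEQ_power_zero) auto
  ultimately have "eventually (\<lambda>n. \<theta> ^ n < \<epsilon> \<and> (1 / real d) ^ n < \<epsilon>) sequentially"
    using \<open>\<epsilon> > 0\<close> by (intro eventually_conj order_tendstoD(2)) auto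
  then obtain n where n: "\<theta> ^ n < \<epsilon>" "(1 / real d) ^ n < \<epsilon>"
    by (auto simp: eventually_sequentially)
  define \<rho> where "\<rho> = 1 / real d ^ (m * n)"
  have "\<rho> \<le> (1 / real d) ^ n"
    using d2 \<open>m > 0\<close> unfolding \<rho>_def power_divide power_one
    by (intro divide_left_mono power_increasing) auto
  then have \<rho>: "0 \<le> \<rho>" "\<rho> \<le> \<epsilon>" using n(2) by (auto simp: \<rho>_def)
  obtain I where I: "finite I"
      "A \<subseteq> (\<Union>w\<in>I. {real w / real d ^ (m * n) - x..(real w + 1) / real d ^ (m * n) - x})"
      "real (card I) * \<rho> powr s \<le> \<theta> ^ n"
    using cov[of n] unfolding \<rho>_def by (elim exE conjE)
  have "diameter {real w / real d ^ (m * n) - x..(real w + 1) / real d ^ (m * n) - x} = \<rho>" for w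
  proof -
    have "real w / real d ^ (m * n) \<le> (real w + 1) / real d ^ (m * n)"
      by (intro divide_right_mono) auto
    then show ?thesis by (simp add: \<rho>_def diff_divide_distrib[symmetric])
  qed
  then show "\<exists>(I :: nat set) C \<rho>. finite I \<and> A \<subseteq> (\<Union>i\<in>I. C i) \<and> 0 \<le> \<rho> \<and> \<rho> \<le> \<epsilon> \<and>
      (\<forall>i\<in>I. bounded (C i) \<and> diameter (C i) \<le> \<rho>) \<and> real (card I) * \<rho> powr s < \<epsilon>"
    using I \<rho> n(1)
    by (intro exI[of _ I] exI[of _ \<rho>]
        exI[of _ "\<lambda>w. {real w / real d ^ (m * n) - x..(real w + 1) / real d ^ (m * n) - x}"]) auto
qed

lemma hausdorff_measure_0_above_dim:
  assumes "s > dim" "A \<subseteq> translate (digit_set d E) x"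
  shows "hausdorff_measure s A = 0"
proof (rule hausdorff_measure_0_word_covers)
  show "s > 0" using assms(1) dim_pos by simp
  define \<theta> where "\<theta> = real (card E) / real d powr s"
  show "0 \<le> \<theta>" by (simp add: \<theta>_def)
  have "real (card E) < real d powr s"
    unfolding powr_dim[symmetric] using assms(1) d2 by (intro powr_less_mono) auto
  then show "\<theta> < 1" using d2 by (simp add: \<theta>_def divide_less_eq)
  fix n
  have "A \<subseteq> (\<Union>w\<in>digit_words d E n. {real w / real d ^ n - x..(real w + 1) / real d ^ n - x})"
  proof
    fix y assume "y \<in> A"
    then obtain a where a: "\<forall>i. a i \<in> E" "y = digit_val d a - x"
      using assms(2) unfolding translate_def digit_set_eq by auto
    have "digit_prefix d a n \<in> digit_words d E n"
      using a(1) by (intro digit_prefix_in_words) auto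
    moreover have "y \<in> {real (digit_prefix d a n) / real d ^ n - x..(real (digit_prefix d a n) + 1) / real d ^ n - x}"
      using digit_val_in_cylinder[OF a(1), of n] a(2) by auto
    ultimately show "y \<in> (\<Union>w\<in>digit_words d E n. {real w / real d ^ n - x..(real w + 1) / real d ^ n - x})"
      by (rule UN_I)
  qed
  moreover have "real (card (digit_words d E n)) * (1 / real d ^ n) powr s \<le> \<theta> ^ n"
  proof -
    have "real (card (digit_words d E n)) \<le> real (card E) ^ n"
      using card_digit_words_le[OF finite_E, of d n] by (metis of_nat_le_iff of_nat_power)
    then have "real (card (digit_words d E n)) * (1 / real d ^ n) powr s
        \<le> real (card E) ^ n * (1 / real d powr s) ^ n"
      unfolding inverse_power_powr by (intro mult_right_mono) auto
    also have "\<dots> = \<theta> ^ n" by (simp add: \<theta>_def power_divide)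
    finally show ?thesis .
  qed
  ultimately show "\<exists>I. finite I \<and>
      A \<subseteq> (\<Union>w\<in>I. {real w / real d ^ (1 * n) - x..(real w + 1) / real d ^ (1 * n) - x}) \<and>
      real (card I) * (1 / real d ^ (1 * n)) powr s \<le> \<theta> ^ n"
    using finite_digit_words[OF finite_E] by (intro exI[of _ "digit_words d E n"]) simp
qed simp

text \<open>If \<open>x\<close> has prefix \<open>w\<close>, then \<open>x + r\<close> has a prefix within distance 1 of \<open>w + d ^ n * r\<close>.
  That number is not an integer, so two candidate prefixes would be adjacent: the prefix of
  \<open>x + r\<close> is a function of \<open>w\<close>, and so is the difference \<open>\<rho>\<close> of the two tails. A long block of
  digits \<open>d - 1\<close> is then incompatible with \<open>\<rho> > 0\<close>, and a long block of zeros with \<open>\<rho> < 0\<close>.\<close>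

lemma forbidden_block:
  fixes p :: int and q :: nat
  assumes r: "r = real_of_int p / real q" and "q > 0" and q: "real q < real d ^ m"
    and nonint: "real d ^ n * r \<notin> \<int>"
  shows "\<exists>v\<in>digit_words d E m. \<forall>a b. (\<forall>i. a i \<in> E) \<longrightarrow> (\<forall>i. b i \<in> E) \<longrightarrow>
    digit_val d b = digit_val d a + r \<longrightarrow> digit_prefix d a n = w \<longrightarrow>
    digit_prefix d (\<lambda>i. a (i + n)) m \<noteq> v"
proof (cases "\<exists>a b. (\<forall>i. a i \<in> E) \<and> (\<forall>i. b i \<in> E) \<and>
    digit_val d b = digit_val d a + r \<and> digit_prefix d a n = w")
  case False
  \<comment> \<open>No admissible pair has prefix \<open>w\<close>, so any word serves
    vacuously.\<close>
  then show ?thesis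
    using zero_in_digit_words[OF zero_in_E, of d m] by (intro bexI[of _ 0] allI impI) metis+
next
  case True
  then obtain a0 b0 where ab0: "\<forall>i. a0 i \<in> E" "\<forall>i. b0 i \<in> E"
    "digit_val d b0 = digit_val d a0 + r" "digit_prefix d a0 n = w"
    by auto
  define t where "t = digit_prefix d b0 n"
  define \<rho> where "\<rho> = real d ^ n * r - (real t - real w)"
  have \<rho>_nonint: "\<rho> \<notin> \<int>"
  proof
    assume "\<rho> \<in> \<int>"
    then have "\<rho> + (real t - real w) \<in> \<int>" by (intro Ints_add Ints_diff) auto
    then show False using nonint by (simp add: \<rho>_def)
  qed
  have tails: "digit_val d (\<lambda>i. b (i + n)) + (real (digit_prefix d b n) - real t)
      = digit_val d (\<lambda>i. a (i + n)) + \<rho>"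
    if "\<forall>i. a i \<in> E" "\<forall>i. b i \<in> E" "digit_val d b = digit_val d a + r" "digit_prefix d a n = w" for a b
  proof -
    have "real d ^ n * digit_val d b = real d ^ n * digit_val d a + real d ^ n * r"
      using that(3) by (simp add: distrib_left)
    then show ?thesis
      using digit_val_split_E[OF that(1), of n] digit_val_split_E[OF that(2), of n] that(4)
      by (simp add: \<rho>_def)
  qed
  have \<rho>_le: "\<bar>\<rho>\<bar> \<le> 1"
    using tails[OF ab0] digit_val_shift_bounds[OF ab0(1), of n] digit_val_shift_bounds[OF ab0(2), of n]
    by (simp add: t_def abs_le_iff)
  have tails': "digit_val d (\<lambda>i. b (i + n)) = digit_val d (\<lambda>i. a (i + n)) + \<rho>"
    if ab: "\<forall>i. a i \<in> E" "\<forall>i. b i \<in> E" "digit_val d b = digit_val d a + r" "digit_prefix d a n = w" for a b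
  proof -
    have "digit_prefix d b n = t"
    proof (rule ccontr)
      assume "digit_prefix d b n \<noteq> t"
      then have "2 \<le> \<bar>real (digit_prefix d b n) - real t\<bar>"
        unfolding t_def using ab(2) ab0(2) by (intro word_diff_ge_2[of _ n] digit_prefix_in_words) auto
      \<comment> \<open>A prefix of \<open>x + r\<close> other than \<open>t\<close> differs from it
        by at least 2, and the tails can compensate only 1 of this.\<close>
      then have "\<bar>\<rho>\<bar> = 1"
        using tails[OF ab] digit_val_shift_bounds[OF ab(1), of n] digit_val_shift_bounds[OF ab(2), of n] \<rho>_le
        by linarith
      then have "\<rho> = 1 \<or> \<rho> = - 1" by linarith
      then show False using \<rho>_nonint by auto
    qed
    then show ?thesis using tails[OF ab] by simp
  qed
  \<comment> \<open>The number \<open>\<rho>\<close> is a nonzero fraction with denominator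
    \<open>q\<close>, hence larger than \<open>d ^ (-m)\<close> in absolute value. This is why one
    block length works for every \<open>n\<close> and \<open>w\<close>.\<close>
  have "real q * \<rho> = of_int (int d ^ n * p - int q * (int t - int w))"
    using \<open>q > 0\<close> by (simp add: \<rho>_def r algebra_simps)
  moreover have "\<rho> \<noteq> 0" using \<rho>_nonint by auto
  ultimately have "1 \<le> \<bar>real q * \<rho>\<bar>"
    using \<open>q > 0\<close> by (metis Ints_of_int Ints_nonzero_abs_ge1 mult_eq_0_iff of_nat_eq_0_iff less_numeral_extra(3))
  also have "\<dots> = real q * \<bar>\<rho>\<bar>" by (simp add: abs_mult)
  also have "\<dots> < real d ^ m * \<bar>\<rho>\<bar>"
    using q \<open>\<rho> \<noteq> 0\<close> by (intro mult_strict_right_mono) auto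
  finally have \<rho>_ge: "1 < real d ^ m * \<bar>\<rho>\<bar>" .
  show ?thesis
  proof (cases "\<rho> > 0")
    case True
    have "digit_prefix d (\<lambda>i. a (i + n)) m \<noteq> d ^ m - 1"
      if ab: "\<forall>i. a i \<in> E" "\<forall>i. b i \<in> E" "digit_val d b = digit_val d a + r" "digit_prefix d a n = w" for a b
    proof
      assume eq: "digit_prefix d (\<lambda>i. a (i + n)) m = d ^ m - 1"
      have sh: "\<forall>i. a (i + n) \<in> E" using ab(1) by simp
      have "d ^ m \<ge> 1" using d2 by simp
      then have "real (d ^ m - 1) = real d ^ m - 1" by (simp add: of_nat_diff)
      \<comment> \<open>The block puts the tail of \<open>a\<close> within \<open>d ^ (-m)\<close>
        of 1, so adding \<open>\<rho>\<close> would push the tail of \<open>b\<close> beyond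
        1.\<close>
      then have "real d ^ m * digit_val d (\<lambda>i. a (i + n)) \<ge> real d ^ m - 1"
        using digit_val_split_E[OF sh, of m] digit_val_shift_bounds(1)[OF sh, of m] eq by simp
      moreover have "real d ^ m * (digit_val d (\<lambda>i. a (i + n)) + \<rho>) \<le> real d ^ m * 1"
        using tails'[OF ab] digit_val_shift_bounds(2)[OF ab(2), of n] by (intro mult_left_mono) auto
      ultimately show False using \<rho>_ge True by (simp add: distrib_left)
    qed
    then show ?thesis
      using max_in_digit_words[OF _ max_in_E, of m] d2 by (intro bexI[of _ "d ^ m - 1"]) auto
  next
    case False
    have "digit_prefix d (\<lambda>i. a (i + n)) m \<noteq> 0"
      if ab: "\<forall>i. a i \<in> E" "\<forall>i. b i \<in> E" "digit_val d b = digit_val d a + r" "digit_prefix d a n = w" for a b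
    proof
      assume eq: "digit_prefix d (\<lambda>i. a (i + n)) m = 0"
      have sh: "\<forall>i. a (i + n) \<in> E" using ab(1) by simp
      have "real d ^ m * digit_val d (\<lambda>i. a (i + n)) \<le> 1"
        using digit_val_split_E[OF sh, of m] digit_val_shift_bounds(2)[OF sh, of m] eq by simp
      moreover have "real d ^ m * 0 \<le> real d ^ m * (digit_val d (\<lambda>i. a (i + n)) + \<rho>)"
        using tails'[OF ab] digit_val_shift_bounds(1)[OF ab(2), of n] by (intro mult_left_mono) auto
      ultimately show False using \<rho>_ge False by (simp add: distrib_left)
    qed
    then show ?thesis
      using zero_in_digit_words[OF zero_in_E, of d m] by (intro bexI[of _ 0]) auto
  qed
qed

text \<open>Every extension by \<open>m\<close> digits loses one of the at most
  \<open>N = card E ^ m\<close> continuations. Hence at most \<open>(N - 1) ^ j\<close> cylinders of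
  length \<open>d ^ (-m * j)\<close> meet the set, each contributing \<open>1 / N ^ j\<close> in
  exponent \<open>dim\<close>.\<close>

lemma translate_intersection_null:
  fixes p :: int and q :: nat
  assumes r: "r = real_of_int p / real q" and "q > 0" and nonint: "\<And>n. real d ^ n * r \<notin> \<int>"
  shows "hausdorff_measure dim {x \<in> digit_set d E. x + r \<in> digit_set d E} = 0"
    (is "hausdorff_measure dim ?Z = 0")
proof -
  obtain m where m: "real q < real d ^ m"
    using real_arch_pow[of "real d" "real q"] d2 by auto
  have "m > 0" using m \<open>q > 0\<close> by (cases m) auto
  define B where "B j = (\<lambda>a. digit_prefix d a (m * j)) `
      {a. (\<forall>i. a i \<in> E) \<and> digit_val d a + r \<in> digit_set d E}" for j
  have B_words: "B j \<subseteq> digit_words d E (m * j)" for j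
    unfolding B_def by (auto intro: digit_prefix_in_words)
  then have finB: "finite (B j)" for j
    using finite_digit_words[OF finite_E] by (rule finite_subset)
  \<comment> \<open>The forbidden block may depend on the level and on the prefix; only its
    existence matters for the count.\<close>
  have "\<exists>v. \<forall>w. v w \<in> digit_words d E m \<and> (\<forall>a b. (\<forall>i. a i \<in> E) \<longrightarrow> (\<forall>i. b i \<in> E) \<longrightarrow>
    digit_val d b = digit_val d a + r \<longrightarrow> digit_prefix d a (m * j) = w \<longrightarrow>
    digit_prefix d (\<lambda>i. a (i + m * j)) m \<noteq> v w)" for j
    by (rule choice) (use forbidden_block[OF r \<open>q > 0\<close> m nonint] in blast)
  then obtain v where v: "\<And>j w. v j w \<in> digit_words d E m"
    "\<And>j w a b. \<forall>i. a i \<in> E \<Longrightarrow> \<forall>i. b i \<in> E \<Longrightarrow>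
    digit_val d b = digit_val d a + r \<Longrightarrow> digit_prefix d a (m * j) = w \<Longrightarrow>
    digit_prefix d (\<lambda>i. a (i + m * j)) m \<noteq> v j w"
    by metis
  have Bsub: "B (Suc j) \<subseteq> (\<Union>w\<in>B j. (\<lambda>u. d ^ m * w + u) ` (digit_words d E m - {v j w}))" for j
  proof
    fix y assume "y \<in> B (Suc j)"
    then obtain a b where a: "\<forall>i. a i \<in> E" "\<forall>i. b i \<in> E" "digit_val d b = digit_val d a + r"
      "y = digit_prefix d a (m * Suc j)" "digit_val d a + r \<in> digit_set d E"
      unfolding B_def digit_set_eq by auto
    define w where "w = digit_prefix d a (m * j)"
    have "w \<in> B j" unfolding B_def w_def using a(1,5) by (intro imageI) simp
    moreover have "y = d ^ m * w + digit_prefix d (\<lambda>i. a (i + m * j)) m"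
      unfolding a(4) w_def using digit_prefix_add[of d a "m * j" m] by (simp add: add.commute)
    moreover have "digit_prefix d (\<lambda>i. a (i + m * j)) m \<in> digit_words d E m - {v j w}"
      using a(1) v(2)[OF a(1-3) w_def[symmetric]] by (auto intro: digit_prefix_in_words)
    ultimately show "y \<in> (\<Union>w\<in>B j. (\<lambda>u. d ^ m * w + u) ` (digit_words d E m - {v j w}))"
      by auto
  qed
  define N where "N = card E ^ m"
  have N1: "N \<ge> 1" unfolding N_def using card_E_ge_2 by simp
  have cardB: "card (B j) \<le> (N - 1) ^ j" for j
  proof (induction j)
    case 0
    have "B 0 \<subseteq> {0}" using B_words[of 0] by simp
    then show ?case using card_mono[of "{0}" "B 0"] by simp
  next
    case (Suc j)
    have fin: "finite (digit_words d E m)" by (rule finite_digit_words[OF finite_E])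
    have "card (B (Suc j)) \<le> card (\<Union>w\<in>B j. (\<lambda>u. d ^ m * w + u) ` (digit_words d E m - {v j w}))"
      using Bsub fin finB by (intro card_mono) auto
    also have "\<dots> \<le> (\<Sum>w\<in>B j. card ((\<lambda>u. d ^ m * w + u) ` (digit_words d E m - {v j w})))"
      by (rule card_UN_le[OF finB])
    also have "\<dots> \<le> (\<Sum>w\<in>B j. N - 1)"
    proof (rule sum_mono)
      fix w
      have "card ((\<lambda>u. d ^ m * w + u) ` (digit_words d E m - {v j w})) \<le> card (digit_words d E m - {v j w})"
        using fin by (intro card_image_le) simp
      also have "\<dots> = card (digit_words d E m) - 1" using v(1) fin by (simp add: card_Diff_singleton)
      also have "\<dots> \<le> N - 1" unfolding N_def by (intro diff_le_mono card_digit_words_le finite_E)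
      finally show "card ((\<lambda>u. d ^ m * w + u) ` (digit_words d E m - {v j w})) \<le> N - 1" .
    qed
    also have "\<dots> = card (B j) * (N - 1)" by simp
    also have "\<dots> \<le> (N - 1) ^ Suc j" using Suc by (simp add: mult.commute)
    finally show ?case .
  qed
  show ?thesis
  proof (rule hausdorff_measure_0_word_covers[OF dim_pos _ _ \<open>m > 0\<close>])
    show "0 \<le> real (N - 1) / real N" by simp
    show "real (N - 1) / real N < 1" using N1 by (simp add: divide_less_eq)
    fix j
    have "?Z \<subseteq> (\<Union>w\<in>B j. {real w / real d ^ (m * j) - 0..(real w + 1) / real d ^ (m * j) - 0})"
    proof
      fix x assume "x \<in> ?Z"
      then obtain a where a: "\<forall>i. a i \<in> E" "x = digit_val d a" "digit_val d a + r \<in> digit_set d E"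
        unfolding digit_set_eq by auto
      then have "digit_prefix d a (m * j) \<in> B j" unfolding B_def by (intro imageI) simp
      moreover have "x \<in> {real (digit_prefix d a (m * j)) / real d ^ (m * j) - 0..
          (real (digit_prefix d a (m * j)) + 1) / real d ^ (m * j) - 0}"
        using digit_val_in_cylinder[OF a(1), of "m * j"] a(2) by simp
      ultimately show "x \<in> (\<Union>w\<in>B j. {real w / real d ^ (m * j) - 0..(real w + 1) / real d ^ (m * j) - 0})"
        by (rule UN_I)
    qed
    moreover have "real (card (B j)) * (1 / real d ^ (m * j)) powr dim \<le> (real (N - 1) / real N) ^ j"
    proof -
      have "real (card (B j)) \<le> real (N - 1) ^ j"
        using cardB[of j] by (metis of_nat_le_iff of_nat_power)
      moreover have "(1 / real d ^ (m * j)) powr dim = 1 / real N ^ j"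
        unfolding inverse_power_powr powr_dim N_def by (simp add: power_mult power_divide)
      ultimately show ?thesis by (simp add: power_divide divide_right_mono)
    qed
    ultimately show "\<exists>I. finite I \<and>
      ?Z \<subseteq> (\<Union>w\<in>I. {real w / real d ^ (m * j) - 0..(real w + 1) / real d ^ (m * j) - 0}) \<and>
      real (card I) * (1 / real d ^ (m * j)) powr dim \<le> (real (N - 1) / real N) ^ j"
      using finB by (intro exI[of _ "B j"] conjI)
  qed
qed

section \<open>Dimension\<close>

text \<open>Positions \<open>i\<close> with \<open>k dvd Suc i\<close> carry the prescribed digit \<open>g i\<close>; the remaining ones
  carry the base-\<open>card E\<close> digits of \<open>z\<close>, and \<open>i - i div k\<close> counts those before position \<open>i\<close>.\<close>

definition spread :: "nat \<Rightarrow> (nat \<Rightarrow> nat) \<Rightarrow> (nat \<Rightarrow> nat) \<Rightarrow> real \<Rightarrow> nat \<Rightarrow> nat" where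
  "spread k g e z i = (if k dvd Suc i then g i
     else e (nat (\<lfloor>real (card E) ^ Suc (i - i div k) * z\<rfloor> mod int (card E))))"

lemma spread_in_E:
  assumes "\<forall>i. g i \<in> E" "bij_betw e {0..<card E} E"
  shows "spread k g e z i \<in> E"
proof -
  have "nat (u mod int (card E)) \<in> {0..<card E}" for u
    using card_E_ge_2 by (simp add: nat_less_iff)
  then show ?thesis using assms by (auto simp: spread_def dest: bij_betwE)
qed

text \<open>Among the first \<open>j\<close> positions exactly \<open>j - j div k\<close> are free,
  and they reveal that many leading digits of \<open>z\<close>.\<close>

lemma spread_eq_imp_close:
  assumes e: "bij_betw e {0..<card E} E" and z: "z \<in> {0..<1}" "z' \<in> {0..<1}"
    and eq: "\<And>i. i < j \<Longrightarrow> spread k g e z i = spread k g e z' i"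
  shows "\<bar>z - z'\<bar> \<le> 1 / real (card E) ^ (j - j div k)"
proof (rule nary_digits_eq_imp_close[OF _ z])
  show "card E > 0" using card_E_ge_2 by simp
  define D where "D u l = \<lfloor>real (card E) ^ Suc l * u\<rfloor> mod int (card E)" for u l
  have "D z l = D z' l" if "l < j - j div k" for l
    using eq that
  proof (induction j)
    case (Suc j)
    show ?case
    proof (cases "l < j - j div k")
      case True
      then show ?thesis using Suc by simp
    next
      case False
      \<comment> \<open>The count of free positions grows at \<open>j\<close> only if
        \<open>k\<close> does not divide \<open>Suc j\<close>; the new position then carries digit
        number \<open>j - j div k\<close>.\<close>
      have free: "\<not> k dvd Suc j" and l: "l = j - j div k"
        using False Suc.prems(2) div_le_dividend[of j k]
        by (auto simp: div_Suc dvd_eq_mod_eq_0 split: if_splits)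
      have range: "nat (D u l) \<in> {0..<card E}" "D u l \<ge> 0" for u
        using card_E_ge_2 by (simp_all add: D_def nat_less_iff)
      have "e (nat (D z l)) = e (nat (D z' l))"
        using Suc.prems(1)[of j] free by (simp add: spread_def D_def l)
      then have "nat (D z l) = nat (D z' l)"
        using range(1) e by (meson bij_betw_imp_inj_on inj_onD)
      then show ?thesis using range(2) by (metis nat_eq_iff2 int_nat_eq)
    qed
  qed simp
  then show "\<lfloor>real (card E) ^ Suc l * z\<rfloor> mod int (card E) = \<lfloor>real (card E) ^ Suc l * z'\<rfloor> mod int (card E)"
    if "l < j - j div k" for l using that by (simp add: D_def)
qed

text \<open>At the first position \<open>j\<close> where the expansions differ, their values are at
  least \<open>d ^ (-j-1)\<close> apart, while \<open>z\<close> and \<open>z'\<close> share at least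
  \<open>(1 - 1/k) * j\<close> digits in base \<open>card E\<close>. The relation
  \<open>powr_dim\<close> converts one bound into the other.\<close>

lemma spread_expanding:
  assumes g: "\<forall>i. g i \<in> E" and e: "bij_betw e {0..<card E} E" and k: "k \<ge> 2"
    and z: "z \<in> {0..<1}" "z' \<in> {0..<1}"
  defines "\<alpha> \<equiv> (1 - 1 / real k) * dim"
  shows "\<bar>z - z'\<bar> \<le> real d powr \<alpha> *
    \<bar>digit_val d (spread k g e z) - digit_val d (spread k g e z')\<bar> powr \<alpha>"
proof (cases "z = z'")
  case False
  \<comment> \<open>If the expansions coincided, all digits of \<open>z\<close> and
    \<open>z'\<close> would agree: the first \<open>k * M\<close> positions contain at least
    \<open>M\<close> free ones.\<close>
  have ex: "\<exists>j. spread k g e z j \<noteq> spread k g e z' j"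
  proof (rule ccontr)
    assume "\<not> ?thesis"
    then have eq: "spread k g e z i = spread k g e z' i" for i by simp
    have "\<bar>z - z'\<bar> \<le> 1 / 2 ^ M" for M :: nat
    proof -
      have "\<bar>z - z'\<bar> \<le> 1 / real (card E) ^ (k * M - k * M div k)"
        by (rule spread_eq_imp_close[OF e z eq])
      also have "\<dots> \<le> 1 / real (card E) ^ M"
      proof (intro divide_left_mono power_increasing)
        have "2 * M \<le> k * M" "k * M div k = M" using k by simp_all
        then show "M \<le> k * M - k * M div k" by linarith
      qed (use card_E_ge_2 in auto)
      also have "\<dots> \<le> 1 / 2 ^ M"
        using card_E_ge_2 by (intro divide_left_mono power_mono) auto
      finally show ?thesis .
    qed
    moreover obtain M where "(1 / 2) ^ M < \<bar>z - z'\<bar>"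
      using real_arch_pow_inv[of "\<bar>z - z'\<bar>" "1 / 2"] False by auto
    ultimately show False by (metis not_less power_one_over)
  qed
  define j where "j = (LEAST j. spread k g e z j \<noteq> spread k g e z' j)"
  have j: "spread k g e z j \<noteq> spread k g e z' j"
    "\<And>i. i < j \<Longrightarrow> spread k g e z i = spread k g e z' i"
    unfolding j_def using LeastI_ex[OF ex] not_less_Least by blast+
  have a: "\<forall>i. spread k g e z i \<in> E" "\<forall>i. spread k g e z' i \<in> E"
    by (intro allI spread_in_E[OF g e])+
  have "digit_prefix d (spread k g e z) (Suc j) \<noteq> digit_prefix d (spread k g e z') (Suc j)"
  proof
    assume "digit_prefix d (spread k g e z) (Suc j) = digit_prefix d (spread k g e z') (Suc j)"
    from digit_prefix_eq_imp[OF _ _ this] have "spread k g e z j = spread k g e z' j"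
      using a E_less by simp
    then show False using j(1) by simp
  qed
  then have sep: "1 / real d ^ Suc j \<le> \<bar>digit_val d (spread k g e z) - digit_val d (spread k g e z')\<bar>"
    by (rule digit_val_separated[OF a])
  have \<alpha>: "\<alpha> \<ge> 0" using k dim_pos by (simp add: \<alpha>_def)
  have "real (j div k) \<le> real j / real k" by (rule of_nat_div_le_of_nat)
  then have "(1 - 1 / real k) * real j \<le> real (j - j div k)"
    by (simp add: of_nat_diff div_le_dividend algebra_simps)
  then have "real (card E) powr ((1 - 1 / real k) * real j) \<le> real (card E) powr real (j - j div k)"
    using card_E_ge_2 by (intro powr_mono) auto
  moreover have "real (card E) powr ((1 - 1 / real k) * real j) = real d powr (\<alpha> * real j)"
    unfolding powr_dim[symmetric] powr_powr by (simp add: \<alpha>_def algebra_simps)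
  moreover have "real (card E) powr real (j - j div k) = real (card E) ^ (j - j div k)"
    using card_E_ge_2 by (intro powr_realpow) simp
  ultimately have le: "real d powr (\<alpha> * real j) \<le> real (card E) ^ (j - j div k)"
    by metis
  have "\<bar>z - z'\<bar> \<le> 1 / real (card E) ^ (j - j div k)"
    by (rule spread_eq_imp_close[OF e z j(2)])
  also have "\<dots> \<le> 1 / real d powr (\<alpha> * real j)"
    using le d2 card_E_ge_2 by (intro divide_left_mono mult_pos_pos zero_less_power) auto
  \<comment> \<open>The factor \<open>d powr \<alpha>\<close> absorbs the shift from
    \<open>j\<close> to \<open>Suc j\<close>.\<close>
  also have "\<dots> = real d powr \<alpha> * (1 / real d ^ Suc j) powr \<alpha>"
  proof -
    have "(1 / real d powr \<alpha>) ^ Suc j = 1 / (real d powr \<alpha> * real d powr (\<alpha> * real j))"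
      using d2 by (simp add: power_divide powr_powr[symmetric] powr_realpow)
    then show ?thesis unfolding inverse_power_powr using d2 by simp
  qed
  also have "\<dots> \<le> real d powr \<alpha> *
      \<bar>digit_val d (spread k g e z) - digit_val d (spread k g e z')\<bar> powr \<alpha>"
    using sep \<alpha> by (intro mult_left_mono powr_mono2) auto
  finally show ?thesis .
qed simp

text \<open>Stated for a general \<open>A\<close> so as to cover both the digit set itself and the
  set of badly approximable points. The lower bound comes from letting \<open>k\<close> grow, since
  \<open>(1 - 1/k) * dim\<close> tends to \<open>dim\<close>.\<close>

lemma hausdorff_dim_digits_avoiding:
  assumes A: "A \<subseteq> translate (digit_set d E) x"
    and avoid: "\<And>k a. k \<ge> 2 \<Longrightarrow> \<forall>i. a i \<in> E \<Longrightarrow> \<forall>i. k dvd Suc i \<longrightarrow> a i \<noteq> c i \<Longrightarrow> digit_val d a - x \<in> A"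
  shows "hausdorff_dim A = dim"
proof (rule hausdorff_dim_eqI)
  show "0 \<le> dim" using dim_pos by simp
  show "hausdorff_measure s A = 0" if "s > dim" for s
    using that A by (rule hausdorff_measure_0_above_dim)
  fix s assume s: "0 \<le> s" "s < dim"
  \<comment> \<open>The bound \<open>dim / (dim - s)\<close> is what makes
    \<open>s \<le> \<alpha>\<close>.\<close>
  obtain k :: nat where k: "real k > max 2 (dim / (dim - s))" using reals_Archimedean2 by blast
  then have k2: "k \<ge> 2" by simp
  define \<alpha> where "\<alpha> = (1 - 1 / real k) * dim"
  have "dim < real k * (dim - s)" using k s by (simp add: divide_less_eq)
  then have "s * real k \<le> (real k - 1) * dim" by (simp add: algebra_simps)
  then have "s \<le> \<alpha>" using k2 by (simp add: \<alpha>_def field_simps)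
  obtain e where e: "bij_betw e {0..<card E} E" using ex_bij_betw_nat_finite[OF finite_E] by auto
  \<comment> \<open>The digits 0 and \<open>d - 1\<close> are distinct elements of \<open>E\<close>,
    so one of them always differs from \<open>c i\<close>.\<close>
  define g where "g i = (if c i = 0 then d - 1 else 0)" for i
  have g: "\<forall>i. g i \<in> E" "\<forall>i. g i \<noteq> c i" using zero_in_E max_in_E d2 by (auto simp: g_def)
  show "hausdorff_measure s A \<noteq> 0"
  proof (rule hausdorff_measure_pos_of_expanding)
    show "digit_val d (spread k g e z) - x \<in> A" for z
    proof (rule avoid[OF k2])
      show "\<forall>i. spread k g e z i \<in> E" using spread_in_E[OF g(1) e] by simp
      show "\<forall>i. k dvd Suc i \<longrightarrow> spread k g e z i \<noteq> c i" using g(2) by (simp add: spread_def)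
    qed
    show "\<bar>z - z'\<bar> \<le> real d powr \<alpha> *
        \<bar>(digit_val d (spread k g e z) - x) - (digit_val d (spread k g e z') - x)\<bar> powr \<alpha>"
      if "z \<in> {0..<1}" "z' \<in> {0..<1}" for z z'
      using spread_expanding[OF g(1) e k2 that] by (simp add: \<alpha>_def)
    show "0 < \<alpha>" using k2 dim_pos by (simp add: \<alpha>_def)
    show "0 < real d powr \<alpha>" using d2 by simp
  qed (use s \<open>s \<le> \<alpha>\<close> in auto)
qed

lemma hausdorff_dim_digit_set: "hausdorff_dim (digit_set d E) = dim"
  by (rule hausdorff_dim_digits_avoiding[where x = 0 and c = "\<lambda>_. 0"])
    (auto simp: translate_def digit_set_eq)

section \<open>Badly approximable points and the exceptional set\<close>

lemma badly_intr_approx_avoiding: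
  assumes "prime d" and a: "\<forall>i. a i \<in> E" and c: "\<forall>i. c i \<in> E"
    and "k > 0" and avoid: "\<forall>i. k dvd Suc i \<longrightarrow> a i \<noteq> c i"
    and irrat: "digit_val d c \<notin> \<rat>"
    and generic: "\<And>r. r \<in> \<rat> \<Longrightarrow> digit_val d c + r \<in> digit_set d E \<Longrightarrow> \<exists>n. real d ^ n * r \<in> \<int>"
    and "K > 0"
  shows "badly_intr_approx (translate (digit_set d E) (digit_val d c)) (\<lambda>q. K) (digit_val d a - digit_val d c)"
proof -
  define S where "S = translate (digit_set d E) (digit_val d c)"
  \<comment> \<open>For \<open>q = d ^ n\<close> the allowed error \<open>\<epsilon> * K / q\<close>
    becomes half of the separation \<open>d ^ (-n-k)\<close>. No rational at all then satisfies the
    inequality, so the set to be shown finite is empty.\<close>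
  define \<epsilon> where "\<epsilon> = 1 / (2 * K * real d ^ k)"
  have "\<epsilon> > 0" using \<open>K > 0\<close> d2 by (simp add: \<epsilon>_def)
  have False if q: "0 < q" and cop: "coprime p (int q)" and S: "real_of_int p / real q \<in> S"
    and close: "\<bar>(digit_val d a - digit_val d c) - real_of_int p / real q\<bar> \<le> \<epsilon> * K / real q" for p q
  proof -
    define r where "r = real_of_int p / real q"
    from S obtain b where b: "\<forall>i. b i \<in> E" and r: "digit_val d b = digit_val d c + r"
      unfolding S_def translate_def digit_set_eq r_def by auto
    have "digit_val d c + r \<in> digit_set d E" unfolding r[symmetric] digit_set_eq using b by simp
    moreover have "r \<in> \<rat>" by (simp add: r_def)
    ultimately obtain n0 where "real d ^ n0 * r \<in> \<int>" using generic by blast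
    then obtain u :: int where "real d ^ n0 * r = of_int u" by (auto elim: Ints_cases)
    then have "real_of_int (int d ^ n0 * p) = real_of_int (u * int q)"
      using q by (simp add: r_def field_simps)
    then have "int d ^ n0 * p = u * int q" by (simp only: of_int_eq_iff)
    then have "int q dvd int d ^ n0 * p" by simp
    then have "int q dvd int d ^ n0" using cop by (simp add: coprime_commute coprime_dvd_mult_left_iff)
    then have "q dvd d ^ n0" by (metis int_dvd_int_iff of_nat_power)
    \<comment> \<open>Primality of \<open>d\<close> enters here: a divisor of a power of
      \<open>d\<close> is itself a power of \<open>d\<close>.\<close>
    then obtain n where n: "q = d ^ n" using divides_primepow_nat[OF \<open>prime d\<close>] by blast
    have d0: "real d ^ n > 0" "real d ^ k \<ge> 1" using d2 by auto
    have "real d ^ n * digit_val d b = real d ^ n * digit_val d c + real_of_int p"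
      using d0 unfolding r r_def n by (simp add: distrib_left)
    then have tails: "real (digit_prefix d b n) + digit_val d (\<lambda>i. b (i + n))
        = real (digit_prefix d c n) + digit_val d (\<lambda>i. c (i + n)) + real_of_int p"
      using digit_val_split_E[OF b, of n] digit_val_split_E[OF c, of n] by simp
    \<comment> \<open>An integer that is the difference of two tails in [0,1]. If it were nonzero,
      the tail of \<open>c\<close> would be 0 or 1, making \<open>digit_val d c\<close>
      rational.\<close>
    define l where "l = int (digit_prefix d b n) - int (digit_prefix d c n) - p"
    have l: "real_of_int l = digit_val d (\<lambda>i. c (i + n)) - digit_val d (\<lambda>i. b (i + n))"
      using tails by (simp add: l_def)
    have "l = 0"
    proof (rule ccontr)
      assume "l \<noteq> 0"
      then have "real_of_int l \<ge> 1 \<or> real_of_int l \<le> - 1" by linarith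
      then have "digit_val d (\<lambda>i. c (i + n)) = 0 \<or> digit_val d (\<lambda>i. c (i + n)) = 1"
        using l digit_val_shift_bounds[OF b, of n] digit_val_shift_bounds[OF c, of n] by linarith
      then have "digit_val d (\<lambda>i. c (i + n)) \<in> \<rat>" by auto
      then have "(real (digit_prefix d c n) + digit_val d (\<lambda>i. c (i + n))) / real d ^ n \<in> \<rat>"
        by (intro Rats_divide Rats_add Rats_power) auto
      moreover have "(real (digit_prefix d c n) + digit_val d (\<lambda>i. c (i + n))) / real d ^ n = digit_val d c"
        using digit_val_split_E[OF c, of n] d0 by (simp add: field_simps)
      ultimately show False using irrat by simp
    qed
    then have tail_eq: "digit_val d (\<lambda>i. b (i + n)) = digit_val d (\<lambda>i. c (i + n))" using l by simp
    have "\<bar>digit_val d a - digit_val d b\<bar> \<le> \<epsilon> * K / real q"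
      using close r by (simp add: r_def algebra_simps)
    also have "\<dots> = 1 / (2 * real d ^ k) / real d ^ n"
      using \<open>K > 0\<close> by (simp add: \<epsilon>_def n)
    finally have small: "real d ^ n * \<bar>digit_val d a - digit_val d b\<bar> \<le> 1 / (2 * real d ^ k)"
      unfolding pos_le_divide_eq[OF d0(1)] by (simp only: mult.commute)
    have "1 / real d ^ k \<le> real d ^ n * \<bar>digit_val d a - digit_val d b\<bar>"
    proof (cases "digit_prefix d a n = digit_prefix d b n")
      case True
      have sh: "\<forall>i. a (i + n) \<in> E" "\<forall>i. c (i + n) \<in> E" using a c by auto
      \<comment> \<open>With this choice \<open>Suc (i + n)\<close> is the least multiple of
        \<open>k\<close> exceeding \<open>n\<close>, so \<open>a\<close> and \<open>c\<close> differ
        somewhere in the \<open>k\<close> digits after the prefix.\<close>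
      define i where "i = k - 1 - n mod k"
      have "n mod k < k" using \<open>k > 0\<close> by simp
      then have "i < k" and "Suc (i + n) = k + (n - n mod k)" using mod_less_eq_dividend[of n k] by (auto simp: i_def)
      then have "k dvd Suc (i + n)" by (simp add: minus_mod_eq_mult_div)
      then have "a (i + n) \<noteq> c (i + n)" using avoid by blast
      then have "digit_prefix d (\<lambda>i. a (i + n)) k \<noteq> digit_prefix d (\<lambda>i. c (i + n)) k"
        using digit_prefix_eq_imp[of "\<lambda>i. a (i + n)" d "\<lambda>i. c (i + n)" k i] sh E_less \<open>i < k\<close> by auto
      then have "1 / real d ^ k \<le> \<bar>digit_val d (\<lambda>i. a (i + n)) - digit_val d (\<lambda>i. c (i + n))\<bar>"
        by (rule digit_val_separated[OF sh])
      also have "digit_val d (\<lambda>i. a (i + n)) - digit_val d (\<lambda>i. c (i + n))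
          = real d ^ n * digit_val d a - real d ^ n * digit_val d b"
        using digit_val_split_E[OF a, of n] digit_val_split_E[OF b, of n] True tail_eq by simp
      also have "\<bar>\<dots>\<bar> = real d ^ n * \<bar>digit_val d a - digit_val d b\<bar>"
        by (simp add: abs_mult flip: right_diff_distrib)
      finally show ?thesis .
    next
      case False
      \<comment> \<open>If the prefixes of \<open>a\<close> and \<open>b\<close> already differ,
        separation at level \<open>n\<close> gives more than is required.\<close>
      have "1 \<le> real d ^ n * \<bar>digit_val d a - digit_val d b\<bar>"
        using digit_val_separated[OF a b False] d0 by (simp add: divide_le_eq mult.commute)
      moreover have "1 / real d ^ k \<le> 1" using d0 by (simp add: divide_le_eq)
      ultimately show ?thesis by linarith
    qed
    moreover have "1 / (2 * real d ^ k) < 1 / real d ^ k" using d0 d2 by (simp add: divide_strict_left_mono)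
    ultimately show False using small by linarith
  qed
  then have "{(p :: int, q :: nat). 0 < q \<and> coprime p (int q) \<and> real_of_int p / real q \<in> S \<and>
      \<bar>(digit_val d a - digit_val d c) - real_of_int p / real q\<bar> \<le> \<epsilon> * K / real q} = {}"
    by auto
  then have "\<not> intr_approx S (\<lambda>q. \<epsilon> * K) (digit_val d a - digit_val d c)"
    unfolding intr_approx_def by (metis finite.emptyI)
  moreover have "digit_val d a - digit_val d c \<in> S"
    using a by (auto simp: S_def translate_def digit_set_eq)
  ultimately show ?thesis
    using \<open>\<epsilon> > 0\<close> unfolding badly_intr_approx_def S_def by auto
qed

text \<open>The exceptional points lie in the union of the rationals and countably many sets
  \<open>Z r\<close>, one for each rational \<open>r\<close> that no power of \<open>d\<close>
  clears to an integer. Countable sets are null because \<open>dim\<close> is positive.\<close>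

lemma exceptional_set_null:
  assumes "prime d"
  shows "hausdorff_measure dim
           {x \<in> digit_set d E. \<not> (\<forall>K :: real. K > 0 \<longrightarrow>
              hausdorff_dim {y \<in> translate (digit_set d E) x.
                  badly_intr_approx (translate (digit_set d E) x) (\<lambda>q. K) y} = dim)} = 0"
proof -
  define R where "R = {r \<in> \<rat>. \<forall>n. real d ^ n * r \<notin> \<int>}"
  define Z where "Z r = {x \<in> digit_set d E. x + r \<in> digit_set d E}" for r
  have "hausdorff_measure dim (Z r) = 0" if "r \<in> R" for r
  proof -
    have "r \<in> \<rat>" "\<And>n. real d ^ n * r \<notin> \<int>" using that by (auto simp: R_def)
    then obtain p :: int and q :: nat where "q > 0" "r = real_of_int p / real q"
      by (metis Rats_cases' nat_0_le of_nat_0_less_iff of_int_of_nat_eq less_imp_le)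
    then show ?thesis
      unfolding Z_def using \<open>\<And>n. real d ^ n * r \<notin> \<int>\<close> by (intro translate_intersection_null) auto
  qed
  moreover have "countable R" unfolding R_def by (rule countable_subset[OF _ countable_rat]) auto
  ultimately have "hausdorff_measure dim (\<Union>r\<in>R. Z r) = 0" by (intro hausdorff_measure_0_UN)
  then have null: "hausdorff_measure dim ((\<Union>r\<in>R. Z r) \<union> \<rat>) = 0"
    by (intro hausdorff_measure_0_Un hausdorff_measure_0_countable[OF dim_pos countable_rat])
  have "hausdorff_dim {y \<in> translate (digit_set d E) x.
          badly_intr_approx (translate (digit_set d E) x) (\<lambda>q. K) y} = dim"
    if x: "x \<in> digit_set d E" "x \<notin> (\<Union>r\<in>R. Z r) \<union> \<rat>" and "K > 0" for x and K :: real
  proof -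
    from x(1) obtain c where c: "\<forall>i. c i \<in> E" "x = digit_val d c" unfolding digit_set_eq by auto
    show ?thesis
    proof (rule hausdorff_dim_digits_avoiding[where x = x and c = c])
      fix k a assume k: "(2::nat) \<le> k" and a: "\<forall>i. a i \<in> E" "\<forall>i. k dvd Suc i \<longrightarrow> a i \<noteq> c i"
      have "badly_intr_approx (translate (digit_set d E) x) (\<lambda>q. K) (digit_val d a - x)"
        unfolding c(2)
      proof (rule badly_intr_approx_avoiding[OF assms a(1) c(1) _ a(2)])
        show "digit_val d c \<notin> \<rat>" using x(2) c(2) by simp
        show "\<exists>n. real d ^ n * r \<in> \<int>" if "r \<in> \<rat>" "digit_val d c + r \<in> digit_set d E" for r
          using x that unfolding c(2) R_def Z_def by auto
      qed (use k \<open>K > 0\<close> in auto)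
      then show "digit_val d a - x \<in> {y \<in> translate (digit_set d E) x.
          badly_intr_approx (translate (digit_set d E) x) (\<lambda>q. K) y}"
        by (auto simp: badly_intr_approx_def)
    qed auto
  qed
  then show ?thesis by (intro hausdorff_measure_0_subset[OF null]) blast
qed

end

theorem theorem3p7:
  fixes d :: nat and E :: "nat set"
  assumes "d \<ge> 2"
    and "E \<subseteq> {0..<d}"
    and "1 < card E" and "card E < d"
    and "prime d"
    and "0 \<in> E" and "d - 1 \<in> E"
    and "\<forall>a\<in>E. \<forall>b\<in>E. b \<noteq> a + 1"
  shows "hausdorff_measure (hausdorff_dim (digit_set d E))
           {x \<in> digit_set d E. \<not> (\<forall>K :: real. K > 0 \<longrightarrow>
              hausdorff_dim {y \<in> translate (digit_set d E) x.
                  badly_intr_approx (translate (digit_set d E) x) (\<lambda>q. K) y}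
              = hausdorff_dim (digit_set d E))} = 0"
proof -
  interpret sparse_digits d E
    by unfold_locales (use assms in auto)
  show ?thesis
    unfolding hausdorff_dim_digit_set using exceptional_set_null[OF \<open>prime d\<close>] .
qed

end
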